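(* There is a purely combinatorial polynomial-time algorithm that, given an unweighted undirected graph $G=(V,E)$, outputs a cut $S\subseteq V$ with $\varphi(S,1,G)\ge\frac12\max_{S'\subseteq V}\varphi(S',1,G)$; i.e., a $1/2$-approximation for fault tolerant Max-Cut on unweighted graphs against an adaptive adversary and a single fault.
   Context: For an unweighted graph $G=(V,E)$, a cut is $S\subseteq V$ and $C_{S,G}$ is the number of edges with exactly one endpoint in $S$. For $F\subseteq V$, $G-F$ is obtained by deleting $F$ and all incident edges. The 1-FT value of $S$ is $\varphi(S,1,G)=\min_{v\in V}C_{S-\{v\},G-\{v\}}$. *)

theory Defs
  imports "HOL-Computational_Algebra.Polynomial"
begin

section \<open>Cuts and their value under a single vertex fault\<close>

text \<open>A graph is a pair of a vertex set and a set of edges, an edge being the set of its two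
  endpoints.\<close>

type_synonym 'a graph = "'a set \<times> 'a set set"

definition simple_graph :: "'a graph \<Rightarrow> bool" where
  "simple_graph G \<longleftrightarrow> finite (fst G) \<and> (\<forall>e \<in> snd G. e \<subseteq> fst G \<and> card e = 2)"

definition cut_size :: "'a set \<Rightarrow> 'a graph \<Rightarrow> nat" where
  "cut_size S G = card {e \<in> snd G. card (e \<inter> S) = 1}"

definition delete_vertices :: "'a graph \<Rightarrow> 'a set \<Rightarrow> 'a graph" where
  "delete_vertices G F = (fst G - F, {e \<in> snd G. e \<inter> F = {}})"

text \<open>Meaningful only for a finite nonempty vertex set, where the minimum exists.\<close>

definition ft_value :: "'a set \<Rightarrow> 'a graph \<Rightarrow> nat" where
  "ft_value S G = Min ((\<lambda>v. cut_size (S - {v}) (delete_vertices G {v})) ` fst G)"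


section \<open>Programs and their running time\<close>

text \<open>
  Algorithms are programs of a deterministic while language over zero-based arrays of natural
  numbers; a scalar variable is cell 0 of an array. Addition, truncated subtraction and
  comparison are the only operations on numbers. There is no multiplication, so a step adds
  only a constant number of bits to the largest stored number, and the
  unit-cost measure below is polynomially related to Turing machine time.
\<close>

type_synonym store = "string \<Rightarrow> nat \<Rightarrow> nat"

datatype aexp =
    Const nat
  | Read string aexp
  | Plus aexp aexp
  | Minus aexp aexp

datatype bexp =
    Less aexp aexp
  | Equal aexp aexp
  | Not bexp
  | And bexp bexp

datatype com =
    Skip
  | Assign string aexp aexp
  | Seq com com
  | If bexp com com
  | While bexp com

primrec aval :: "aexp \<Rightarrow> store \<Rightarrow> nat" where
  "aval (Const k) s = k"
| "aval (Read x i) s = s x (aval i s)"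
| "aval (Plus a b) s = aval a s + aval b s"
| "aval (Minus a b) s = aval a s - aval b s"

primrec bval :: "bexp \<Rightarrow> store \<Rightarrow> bool" where
  "bval (Less a b) s \<longleftrightarrow> aval a s < aval b s"
| "bval (Equal a b) s \<longleftrightarrow> aval a s = aval b s"
| "bval (Not b) s \<longleftrightarrow> \<not> bval b s"
| "bval (And b c) s \<longleftrightarrow> bval b s \<and> bval c s"

primrec acost :: "aexp \<Rightarrow> nat" where
  "acost (Const k) = 1"
| "acost (Read x i) = 1 + acost i"
| "acost (Plus a b) = 1 + acost a + acost b"
| "acost (Minus a b) = 1 + acost a + acost b"

primrec bcost :: "bexp \<Rightarrow> nat" where
  "bcost (Less a b) = 1 + acost a + acost b"
| "bcost (Equal a b) = 1 + acost a + acost b"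
| "bcost (Not b) = 1 + bcost b"
| "bcost (And b c) = 1 + bcost b + bcost c"

text \<open>\<open>exec c s t s'\<close>: started in store \<open>s\<close>, program \<open>c\<close> halts after \<open>t\<close> elementary operations in
  store \<open>s'\<close>. The command \<open>Assign x i a\<close> sets cell \<open>i\<close> of array \<open>x\<close> to \<open>a\<close>.\<close>

inductive exec :: "com \<Rightarrow> store \<Rightarrow> nat \<Rightarrow> store \<Rightarrow> bool" where
  Skip: "exec Skip s 1 s"
| Assign: "exec (Assign x i a) s (1 + acost i + acost a)
    (s(x := (s x)(aval i s := aval a s)))"
| Seq: "exec c1 s t1 s1 \<Longrightarrow> exec c2 s1 t2 s2 \<Longrightarrow> exec (Seq c1 c2) s (t1 + t2) s2"
| IfTrue: "bval b s \<Longrightarrow> exec c1 s t s1 \<Longrightarrow> exec (If b c1 c2) s (1 + bcost b + t) s1"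
| IfFalse: "\<not> bval b s \<Longrightarrow> exec c2 s t s1 \<Longrightarrow> exec (If b c1 c2) s (1 + bcost b + t) s1"
| WhileFalse: "\<not> bval b s \<Longrightarrow> exec (While b c) s (1 + bcost b) s"
| WhileTrue: "bval b s \<Longrightarrow> exec c s t1 s1 \<Longrightarrow> exec (While b c) s1 t2 s2 \<Longrightarrow>
    exec (While b c) s (1 + bcost b + t1 + t2) s2"

inductive_cases exec_SkipE: "exec Skip s t s'"
inductive_cases exec_AssignE: "exec (Assign x i a) s t s'"
inductive_cases exec_SeqE: "exec (Seq c1 c2) s t s'"
inductive_cases exec_IfE: "exec (If b c1 c2) s t s'"
inductive_cases exec_WhileE: "exec (While b c) s t s'"

lemma exec_deterministic:
  "exec c s t s' \<Longrightarrow> exec c s u s'' \<Longrightarrow> u = t \<and> s'' = s'"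
proof (induction arbitrary: u s'' rule: exec.induct)
  case (Skip s)
  then show ?case by (auto elim: exec_SkipE)
next
  case (Assign x i a s)
  then show ?case by (auto elim: exec_AssignE)
next
  case (Seq c1 s t1 s1 c2 t2 s2)
  from Seq.prems show ?case
    by (rule exec_SeqE) (metis Seq.IH)
next
  case (IfTrue b s c1 t s1 c2)
  from IfTrue.prems show ?case
    by (rule exec_IfE) (use IfTrue.hyps(1) in \<open>auto dest!: IfTrue.IH\<close>)
next
  case (IfFalse b s c2 t s1 c1)
  from IfFalse.prems show ?case
    by (rule exec_IfE) (use IfFalse.hyps(1) in \<open>auto dest!: IfFalse.IH\<close>)
next
  case (WhileFalse b s c)
  from WhileFalse.prems show ?case
    by (rule exec_WhileE) (simp_all add: WhileFalse.hyps)
next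
  case (WhileTrue b s c t1 s1 t2 s2)
  from WhileTrue.prems show ?case
    by (rule exec_WhileE) (use WhileTrue.hyps(1) in \<open>auto dest!: WhileTrue.IH\<close>)
qed


section \<open>Encoding of instances and solutions\<close>

text \<open>A graph on the vertices \<open>0, \<dots>, n - 1\<close> is given by \<open>n\<close> and its adjacency matrix, stored row by
  row in array \<open>A\<close>; all other cells are initially 0. A cut is returned as its characteristic
  vector in array \<open>S\<close>.\<close>

definition graph_input :: "nat \<Rightarrow> nat set set \<Rightarrow> store" where
  "graph_input n E = (\<lambda>x i.
     if x = ''n'' \<and> i = 0 then n
     else if x = ''A'' \<and> i < n * n \<and> {i div n, i mod n} \<in> E then 1
     else 0)"

definition cut_output :: "nat \<Rightarrow> store \<Rightarrow> nat set" where
  "cut_output n s = {v. v < n \<and> s ''S'' v \<noteq> 0}"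

end

(* Write C for the number of edges cut by S, d(v) for the number of those at v, D for the maximum of d and
m for the number of edges; the 1-FT value of S is C - D. Local search by single-vertex flips, increasing
C and, for equal C, decreasing D, ends after polynomially many steps. The claim is that a
local optimum S has at least half of the optimal value.

Put x(v) = 2 d(v) - deg(v), which is nonnegative as C cannot be increased. The optimum is at most
m - deg(u) for every u. If C - D is less than half of it, this gives
(sum of x) < 2 x(u) + 4 (D - d(u)), so that the vertex v with d(v) = D is unique and
(sum of x) <= 2 x(v) - 2 by parity. Flipping a vertex u with x(u) = 0 across the cut from v leaves C unchanged
and lowers d(v), so u has an uncut neighbour w with d(w) = D - 1. These constraints
leave only x(v) = 2 and x = 0 elsewhere, and a better cut T must cut every edge except possibly {v, w}.
Summing x with signs +1 on T and -1 off T counts each edge cut by T with weight 0, so {v, w} is an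
edge, not cut by T but cut by S. Now w itself can be flipped, which yields a third vertex of the
same degree as v, and this contradicts the value of T. *)

theory Submission
  imports Defs
begin

section \<open>Locally optimal cuts\<close>

definition crosses :: "'a set \<Rightarrow> 'a set \<Rightarrow> bool" where
  "crosses S e \<longleftrightarrow> card (e \<inter> S) = 1"

definition flip :: "'a \<Rightarrow> 'a set \<Rightarrow> 'a set" where
  "flip u S = (if u \<in> S then S - {u} else insert u S)"

lemma mem_flip: "w \<in> flip u S \<longleftrightarrow> (if w = u then w \<notin> S else w \<in> S)"
  by (auto simp: flip_def)

lemma crosses_pair:
  assumes "a \<noteq> b"
  shows "crosses S {a, b} \<longleftrightarrow> (a \<in> S) \<noteq> (b \<in> S)"
  using assms by (auto simp: crosses_def Int_insert_left)

locale finite_simple_graph =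
  fixes V :: "'a set" and E :: "'a set set"
  assumes simple: "simple_graph (V, E)" and nonempty: "V \<noteq> {}"
begin

section \<open>Edges as pairs of vertices\<close>

lemma finite_V: "finite V" and edge_subset: "e \<in> E \<Longrightarrow> e \<subseteq> V" and card_edge: "e \<in> E \<Longrightarrow> card e = 2"
  using simple by (auto simp: simple_graph_def)

lemma finite_E: "finite E"
  using finite_V edge_subset by (meson PowI finite_Pow_iff finite_subset subsetI)

lemma edge_pair:
  assumes "e \<in> E" "u \<in> e"
  obtains w where "w \<noteq> u" "e = {u, w}" "w \<in> V"
proof -
  obtain a b where "e = {a, b}" "a \<noteq> b"
    using card_edge[OF assms(1)] by (auto simp: card_2_iff)
  then have "\<exists>w. w \<noteq> u \<and> e = {u, w} \<and> w \<in> V"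
    using assms(2) edge_subset[OF assms(1)] by (cases "u = a") (auto simp: insert_commute)
  then show thesis
    using that by blast
qed

lemma edge_eq: "e \<in> E \<Longrightarrow> u \<in> e \<Longrightarrow> w \<in> e \<Longrightarrow> u \<noteq> w \<Longrightarrow> e = {u, w}"
  using card_edge by (fastforce simp: card_2_iff)

lemma edge_neq: "{u, w} \<in> E \<Longrightarrow> u \<noteq> w"
  using card_edge by force

section \<open>Degrees within a cut and double counting\<close>

definition vertex_degree :: "'a \<Rightarrow> nat" where
  "vertex_degree u = card {e \<in> E. u \<in> e}"

definition cut_degree :: "'a set \<Rightarrow> 'a \<Rightarrow> nat" where
  "cut_degree S u = card {e \<in> E. u \<in> e \<and> crosses S e}"

definition max_cut_degree :: "'a set \<Rightarrow> nat" where
  "max_cut_degree S = Max (cut_degree S ` V)"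

text \<open>The drop of \<open>cut_size\<close> when \<open>u\<close> changes sides; equivalently,
  cut minus uncut edges at \<open>u\<close>.\<close>

definition excess :: "'a set \<Rightarrow> 'a \<Rightarrow> int" where
  "excess S u = 2 * int (cut_degree S u) - int (vertex_degree u)"

lemma cut_degree_le_max: "u \<in> V \<Longrightarrow> cut_degree S u \<le> max_cut_degree S"
  by (simp add: max_cut_degree_def finite_V)

lemma max_cut_degree_attained:
  obtains v where "v \<in> V" "cut_degree S v = max_cut_degree S"
proof -
  have "Max (cut_degree S ` V) \<in> cut_degree S ` V"
    using finite_V nonempty by (intro Max_in) auto
  then show thesis
    by (auto simp: max_cut_degree_def intro: that)
qed

lemma cut_size_crosses: "cut_size S (V, E) = card {e \<in> E. crosses S e}"
  by (simp add: cut_size_def crosses_def)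

text \<open>Double counting of incidences with vertex weights \<open>f\<close> and edge weights
  \<open>g\<close>. With \<open>f\<close> constantly 1 it is the handshake lemma; with signs as
  weights it yields the identity behind \<open>excess_parity_contradiction\<close>.\<close>

lemma sum_incident:
  fixes g :: "'a set \<Rightarrow> int"
  shows "(\<Sum>u\<in>V. f u * (\<Sum>e | e \<in> E \<and> u \<in> e. g e)) = (\<Sum>e\<in>E. g e * (\<Sum>u\<in>e. f u))"
proof -
  have "(\<Sum>u\<in>V. f u * (\<Sum>e | e \<in> E \<and> u \<in> e. g e)) = (\<Sum>u\<in>V. \<Sum>e | e \<in> E \<and> u \<in> e. f u * g e)"
    by (simp add: sum_distrib_left)
  also have "\<dots> = (\<Sum>e\<in>E. \<Sum>u | u \<in> V \<and> u \<in> e. f u * g e)"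
    by (rule sum.swap_restrict[OF finite_V finite_E])
  also have "\<dots> = (\<Sum>e\<in>E. \<Sum>u\<in>e. f u * g e)"
  proof (intro sum.cong refl)
    show "{u. u \<in> V \<and> u \<in> e} = e" if "e \<in> E" for e
      using edge_subset[OF that] by auto
  qed
  finally show ?thesis
    by (simp add: sum_distrib_left mult.commute)
qed

lemma cut_degree_sum: "int (cut_degree S u) = (\<Sum>e | e \<in> E \<and> u \<in> e. of_bool (crosses S e))"
  unfolding cut_degree_def
  by (subst sum_of_bool_eq) (auto simp: finite_E Int_def conj_ac intro!: arg_cong[where f = card])

lemma excess_sum: "excess S u = (\<Sum>e | e \<in> E \<and> u \<in> e. if crosses S e then 1 else -1)"
proof -
  have "int (vertex_degree u) = (\<Sum>e | e \<in> E \<and> u \<in> e. 1)"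
    by (simp add: vertex_degree_def)
  then have "excess S u = (\<Sum>e | e \<in> E \<and> u \<in> e. 2 * of_bool (crosses S e) - 1)"
    by (simp add: excess_def cut_degree_sum sum_subtractf sum_distrib_left)
  also have "\<dots> = (\<Sum>e | e \<in> E \<and> u \<in> e. if crosses S e then 1 else -1)"
    by (intro sum.cong) auto
  finally show ?thesis .
qed

lemma sum_cut_degree: "(\<Sum>u\<in>V. cut_degree S u) = 2 * cut_size S (V, E)"
proof -
  have "int (\<Sum>u\<in>V. cut_degree S u) = (\<Sum>e\<in>E. of_bool (crosses S e) * (\<Sum>u\<in>e. 1))"
    using sum_incident[of "\<lambda>_. 1" "\<lambda>e. of_bool (crosses S e)"] by (simp add: cut_degree_sum)
  also have "\<dots> = (\<Sum>e\<in>E. 2 * of_bool (crosses S e))"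
    by (intro sum.cong) (auto simp: card_edge)
  also have "\<dots> = int (2 * cut_size S (V, E))"
    by (simp add: cut_size_crosses finite_E Int_def flip: sum_distrib_left)
  finally show ?thesis
    by linarith
qed

lemma sum_excess: "(\<Sum>u\<in>V. excess S u) = 4 * int (cut_size S (V, E)) - 2 * int (card E)"
proof -
  have "(\<Sum>u\<in>V. int (vertex_degree u)) = (\<Sum>e\<in>E. 1 * (\<Sum>u\<in>e. 1))"
    using sum_incident[of "\<lambda>_. 1" "\<lambda>_. 1"] by (simp add: vertex_degree_def)
  also have "\<dots> = 2 * int (card E)"
    by (simp add: card_edge)
  finally show ?thesis
    using sum_cut_degree[of S]
    by (simp add: excess_def sum_subtractf flip: sum_distrib_left of_nat_sum)
qed

lemma uncut_degree: "card {e \<in> E. u \<in> e \<and> \<not> crosses S e} + cut_degree S u = vertex_degree u"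
proof -
  have "{e \<in> E. u \<in> e} = {e \<in> E. u \<in> e \<and> \<not> crosses S e} \<union> {e \<in> E. u \<in> e \<and> crosses S e}"
    by auto
  then show ?thesis
    unfolding vertex_degree_def cut_degree_def
    by (simp only:) (subst card_Un_disjoint, auto simp: finite_E)
qed

text \<open>An edge at \<open>u\<close> is determined by its other end. Matrix rows and the set
  \<open>N\<close> of \<open>locally_optimal_half\<close> count neighbours rather than
  edges.\<close>

lemma cut_degree_neighbors:
  "cut_degree S u = card {w \<in> V. {u, w} \<in> E \<and> (u \<in> S) \<noteq> (w \<in> S)}"
proof -
  have "bij_betw (\<lambda>w. {u, w}) {w \<in> V. {u, w} \<in> E \<and> (u \<in> S) \<noteq> (w \<in> S)} {e \<in> E. u \<in> e \<and> crosses S e}"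
  proof (rule bij_betw_imageI)
    show "inj_on (\<lambda>w. {u, w}) {w \<in> V. {u, w} \<in> E \<and> (u \<in> S) \<noteq> (w \<in> S)}"
      by (auto simp: inj_on_def doubleton_eq_iff)
    show "(\<lambda>w. {u, w}) ` {w \<in> V. {u, w} \<in> E \<and> (u \<in> S) \<noteq> (w \<in> S)} = {e \<in> E. u \<in> e \<and> crosses S e}"
    proof (intro equalityI subsetI)
      fix e assume "e \<in> {e \<in> E. u \<in> e \<and> crosses S e}"
      moreover from this obtain w where "w \<noteq> u" "e = {u, w}" "w \<in> V"
        by (auto elim: edge_pair)
      ultimately show "e \<in> (\<lambda>w. {u, w}) ` {w \<in> V. {u, w} \<in> E \<and> (u \<in> S) \<noteq> (w \<in> S)}"
        by (auto simp: crosses_pair)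
    qed (auto simp: crosses_pair edge_neq)
  qed
  from bij_betw_same_card[OF this] show ?thesis
    unfolding cut_degree_def by (rule sym)
qed

section \<open>Effect of a single flip\<close>

lemma crosses_flip: "e \<in> E \<Longrightarrow> crosses (flip u S) e \<longleftrightarrow> (crosses S e \<noteq> (u \<in> e))"
proof -
  assume e: "e \<in> E"
  then obtain a b where "e = {a, b}" "a \<noteq> b"
    using card_edge[OF e] by (auto simp: card_2_iff)
  then show ?thesis
    by (auto simp: crosses_pair mem_flip)
qed

lemma cut_degree_flip_self: "cut_degree (flip u S) u + cut_degree S u = vertex_degree u"
proof -
  have "{e \<in> E. u \<in> e \<and> crosses (flip u S) e} = {e \<in> E. u \<in> e \<and> \<not> crosses S e}"
    by (auto simp: crosses_flip)
  then show ?thesis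
    using uncut_degree[of u S] by (simp add: cut_degree_def)
qed

lemma cut_size_split:
  "cut_size S (V, E) = card {e \<in> E. u \<notin> e \<and> crosses S e} + cut_degree S u"
proof -
  have "{e \<in> E. crosses S e} = {e \<in> E. u \<notin> e \<and> crosses S e} \<union> {e \<in> E. u \<in> e \<and> crosses S e}"
    by auto
  then show ?thesis
    unfolding cut_size_crosses cut_degree_def
    by (simp only:) (subst card_Un_disjoint, auto simp: finite_E)
qed

text \<open>Edges avoiding \<open>u\<close> keep their status, so the cut changes exactly as the cut
  degree of \<open>u\<close> does.\<close>

lemma cut_size_flip:
  "cut_size (flip u S) (V, E) + cut_degree S u = cut_size S (V, E) + cut_degree (flip u S) u"
proof -
  have "{e \<in> E. u \<notin> e \<and> crosses (flip u S) e} = {e \<in> E. u \<notin> e \<and> crosses S e}"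
    by (auto simp: crosses_flip)
  then show ?thesis
    using cut_size_split[of S u] cut_size_split[of "flip u S" u] by simp
qed

lemma cut_degree_flip_crossing:
  assumes "{u, w} \<in> E" "crosses S {u, w}"
  shows "cut_degree (flip u S) w < cut_degree S w"
proof -
  note * = edge_eq[OF _ _ _ edge_neq[OF assms(1)]]
  have "{e \<in> E. w \<in> e \<and> crosses (flip u S) e} \<subseteq> {e \<in> E. w \<in> e \<and> crosses S e}"
    using assms(2) by (auto simp: crosses_flip dest: *)
  moreover have "{u, w} \<in> {e \<in> E. w \<in> e \<and> crosses S e} - {e \<in> E. w \<in> e \<and> crosses (flip u S) e}"
    using assms by (auto simp: crosses_flip)
  ultimately show ?thesis
    unfolding cut_degree_def by (intro psubset_card_mono) (auto simp: finite_E)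
qed

text \<open>An edge at \<open>w\<close> changes status only if it also contains \<open>u\<close>, so
  \<open>{u, w}\<close> is the only one that can become cut.\<close>

lemma cut_degree_flip_le:
  assumes "w \<noteq> u"
  shows "cut_degree (flip u S) w \<le> cut_degree S w + of_bool ({u, w} \<in> E \<and> \<not> crosses S {u, w})"
proof -
  let ?B = "{e \<in> E. w \<in> e \<and> crosses S e}"
  have sub: "{e \<in> E. w \<in> e \<and> crosses (flip u S) e}
    \<subseteq> (if {u, w} \<in> E \<and> \<not> crosses S {u, w} then insert {u, w} ?B else ?B)"
  proof
    fix e assume e: "e \<in> {e \<in> E. w \<in> e \<and> crosses (flip u S) e}"
    show "e \<in> (if {u, w} \<in> E \<and> \<not> crosses S {u, w} then insert {u, w} ?B else ?B)"
    proof (cases "u \<in> e")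
      case True
      then have "e = {u, w}"
        using edge_eq[of e u w] e assms by auto
      then show ?thesis
        using e by (auto simp: crosses_flip)
    qed (use e in \<open>auto simp: crosses_flip\<close>)
  qed
  have "card {e \<in> E. w \<in> e \<and> crosses (flip u S) e}
    \<le> card (if {u, w} \<in> E \<and> \<not> crosses S {u, w} then insert {u, w} ?B else ?B)"
    by (rule card_mono[OF _ sub]) (auto simp: finite_E)
  also have "\<dots> \<le> card ?B + of_bool ({u, w} \<in> E \<and> \<not> crosses S {u, w})"
    by (auto simp: card_insert_if finite_E)
  finally show ?thesis
    by (simp add: cut_degree_def)
qed

section \<open>The value after a fault and upper bounds for it\<close>

lemma cut_size_delete:
  "cut_size (S - {v}) (delete_vertices (V, E) {v}) + cut_degree S v = cut_size S (V, E)"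
proof -
  have "e \<in> snd (delete_vertices (V, E) {v}) \<and> card (e \<inter> (S - {v})) = 1 \<longleftrightarrow>
      e \<in> E \<and> v \<notin> e \<and> crosses S e" for e
  proof (cases "v \<in> e")
    case False
    then have "e \<inter> (S - {v}) = e \<inter> S"
      by auto
    then show ?thesis
      using False by (simp add: delete_vertices_def crosses_def)
  qed (simp add: delete_vertices_def)
  then have "{e \<in> snd (delete_vertices (V, E) {v}). card (e \<inter> (S - {v})) = 1} = {e \<in> E. v \<notin> e \<and> crosses S e}"
    by (intro Collect_cong)
  then show ?thesis
    using cut_size_split[of S v] by (simp add: cut_size_def)
qed

lemma ft_value_le: "v \<in> V \<Longrightarrow> ft_value S (V, E) + cut_degree S v \<le> cut_size S (V, E)"
  using cut_size_delete[of S v] finite_V by (simp add: ft_value_def flip: cut_size_delete[of S v])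

text \<open>A fault at a vertex destroys exactly the cut edges there, so the worst fault hits a
  vertex of maximum cut degree.\<close>

lemma ft_value_eq: "ft_value S (V, E) + max_cut_degree S = cut_size S (V, E)"
proof (rule antisym)
  obtain v where "v \<in> V" "cut_degree S v = max_cut_degree S"
    by (rule max_cut_degree_attained)
  then show "ft_value S (V, E) + max_cut_degree S \<le> cut_size S (V, E)"
    using ft_value_le by metis
  have "ft_value S (V, E) \<in> (\<lambda>v. cut_size (S - {v}) (delete_vertices (V, E) {v})) ` V"
    unfolding ft_value_def using finite_V nonempty by (auto intro!: Min_in)
  then obtain u where "u \<in> V" "ft_value S (V, E) = cut_size (S - {u}) (delete_vertices (V, E) {u})"
    by auto
  then show "cut_size S (V, E) \<le> ft_value S (V, E) + max_cut_degree S"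
    using cut_size_delete[of S u] cut_degree_le_max[of u S] by simp
qed

text \<open>Cut edges avoiding \<open>u\<close> and edges at \<open>u\<close> form disjoint subsets
  of \<open>E\<close>; in the case of equality they exhaust \<open>E\<close>.\<close>

lemma crossing_or_incident_le:
  "card {e \<in> E. u \<notin> e \<and> crosses S e} + vertex_degree u \<le> card E"
  "card {e \<in> E. u \<notin> e \<and> crosses S e} + vertex_degree u = card E \<Longrightarrow> e \<in> E \<Longrightarrow> u \<notin> e \<Longrightarrow> crosses S e"
proof -
  let ?A = "{e \<in> E. u \<notin> e \<and> crosses S e} \<union> {e \<in> E. u \<in> e}"
  have A: "card ?A = card {e \<in> E. u \<notin> e \<and> crosses S e} + vertex_degree u"
    unfolding vertex_degree_def by (subst card_Un_disjoint) (auto simp: finite_E)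
  have "?A \<subseteq> E"
    by auto
  then show "card {e \<in> E. u \<notin> e \<and> crosses S e} + vertex_degree u \<le> card E"
    using card_mono[OF finite_E \<open>?A \<subseteq> E\<close>] by (simp only: A)
  assume "card {e \<in> E. u \<notin> e \<and> crosses S e} + vertex_degree u = card E" and e: "e \<in> E" "u \<notin> e"
  then have "?A = E"
    using card_subset_eq[OF finite_E \<open>?A \<subseteq> E\<close>] by (simp only: A)
  then show "crosses S e"
    using e by blast
qed

text \<open>Only cut edges avoiding \<open>u\<close> survive a fault at \<open>u\<close>. Used for
  the competing cut, this bounds the optimum.\<close>

lemma ft_value_degree:
  assumes "u \<in> V"
  shows "ft_value S (V, E) + vertex_degree u \<le> card E"
  using ft_value_le[OF assms, of S] cut_size_split[of S u] crossing_or_incident_le(1)[of u S] by linarith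

lemma all_cross_of_ft_value:
  assumes "u \<in> V" "ft_value S (V, E) + vertex_degree u = card E" "e \<in> E" "u \<notin> e"
  shows "crosses S e"
proof -
  have "card {e \<in> E. u \<notin> e \<and> crosses S e} + vertex_degree u = card E"
    using ft_value_le[OF assms(1), of S] cut_size_split[of S u] crossing_or_incident_le(1)[of u S] assms(2)
    by linarith
  then show ?thesis
    using assms(3,4) by (rule crossing_or_incident_le(2))
qed

section \<open>Local optimality and the approximation ratio\<close>

definition improves :: "'a set \<Rightarrow> 'a set \<Rightarrow> bool" where
  "improves S' S \<longleftrightarrow> cut_size S (V, E) < cut_size S' (V, E) \<or>
     cut_size S (V, E) = cut_size S' (V, E) \<and> max_cut_degree S' < max_cut_degree S"

definition locally_optimal :: "'a set \<Rightarrow> bool" where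
  "locally_optimal S \<longleftrightarrow> (\<forall>u\<in>V. \<not> improves (flip u S) S)"

lemma locally_optimal_excess:
  assumes "locally_optimal S" "u \<in> V"
  shows "excess S u \<ge> 0"
proof -
  have "cut_size (flip u S) (V, E) \<le> cut_size S (V, E)"
    using assms unfolding locally_optimal_def improves_def by (meson not_le)
  then show ?thesis
    using cut_size_flip[of u S] cut_degree_flip_self[of u S] by (simp add: excess_def)
qed

text \<open>Flipping \<open>u\<close> keeps the cut size, so the maximum cut degree cannot fall. But
  \<open>v\<close> loses a cut edge and \<open>u\<close> keeps its degree, which is below the
  maximum. Hence a third vertex \<open>w\<close> reaches the old maximum, and it can gain only the
  edge \<open>{u, w}\<close>.\<close>

lemma locally_optimal_swap:
  assumes opt: "locally_optimal S"
    and v: "v \<in> V" "cut_degree S v = max_cut_degree S"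
    and uniq: "\<And>w. w \<in> V \<Longrightarrow> w \<noteq> v \<Longrightarrow> cut_degree S w < max_cut_degree S"
    and u: "{u, v} \<in> E" "crosses S {u, v}" "excess S u = 0"
  shows "\<exists>w\<in>V. w \<noteq> v \<and> w \<noteq> u \<and> {u, w} \<in> E \<and> \<not> crosses S {u, w} \<and>
    Suc (cut_degree S w) = max_cut_degree S"
proof -
  have uV: "u \<in> V" and uv: "u \<noteq> v"
    using edge_subset[OF u(1)] edge_neq[OF u(1)] by auto
  have same: "cut_degree (flip u S) u = cut_degree S u"
    using u(3) cut_degree_flip_self[of u S] by (simp add: excess_def)
  then have "\<not> max_cut_degree (flip u S) < max_cut_degree S"
    using opt uV cut_size_flip[of u S] by (auto simp: locally_optimal_def improves_def)
  moreover obtain w where w: "w \<in> V" "cut_degree (flip u S) w = max_cut_degree (flip u S)"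
    by (rule max_cut_degree_attained)
  ultimately have ge: "max_cut_degree S \<le> cut_degree (flip u S) w"
    by simp
  have "w \<noteq> v"
    using ge cut_degree_flip_crossing[OF u(1,2)] v(2) by auto
  moreover have "w \<noteq> u"
    using ge same uniq[OF uV uv] by auto
  moreover note uniq[OF w(1) \<open>w \<noteq> v\<close>] ge cut_degree_flip_le[OF \<open>w \<noteq> u\<close>, of S]
  ultimately show ?thesis
    using w(1) by (intro bexI[of _ w]) (auto simp: of_bool_def split: if_splits)
qed

lemma excess_le_cut_degree: "excess S u \<le> int (cut_degree S u)"
  using uncut_degree[of u S] by (simp add: excess_def)

text \<open>Sum \<open>excess S\<close> with sign +1 on \<open>T\<close> and -1 off
  \<open>T\<close>. On the vertex side only \<open>v\<close> contributes, with 2 or -2. On the edge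
  side the two ends of an edge cut by \<open>T\<close> cancel. So \<open>{v, w}\<close> must supply
  the whole value: its ends agree in sign and its weight is +1, which means that \<open>S\<close>
  cuts it.\<close>

lemma excess_parity_contradiction:
  assumes v: "v \<in> V" "excess S v = 2" and w: "w \<in> V"
    and zero: "\<forall>u\<in>V - {v}. excess S u = 0"
    and cross: "\<forall>e\<in>E - {{v, w}}. crosses T e"
    and vw: "v \<noteq> w"
  shows "{v, w} \<in> E" "\<not> crosses T {v, w}" "crosses S {v, w}"
proof -
  define \<sigma> :: "'a \<Rightarrow> int" where "\<sigma> u = (if u \<in> T then 1 else -1)" for u
  define s :: "'a set \<Rightarrow> int" where "s e = (if crosses S e then 1 else -1)" for e
  have vanish: "(\<Sum>u\<in>e. \<sigma> u) = 0" if e: "e \<in> E" "crosses T e" for e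
  proof -
    obtain a b where "e = {a, b}" "a \<noteq> b"
      using card_edge[OF e(1)] by (auto simp: card_2_iff)
    then show ?thesis
      using e(2) by (auto simp: crosses_pair \<sigma>_def)
  qed
  have "(\<Sum>u\<in>V. \<sigma> u * excess S u) = (\<Sum>u\<in>V. if u = v then 2 * \<sigma> v else 0)"
    by (intro sum.cong) (auto simp: v zero)
  then have L: "2 * \<sigma> v = (\<Sum>e\<in>E. s e * (\<Sum>u\<in>e. \<sigma> u))"
    using sum_incident[of \<sigma> s] v(1) finite_V by (simp add: excess_sum s_def)
  have "(\<Sum>e\<in>E. s e * (\<Sum>u\<in>e. \<sigma> u)) = (\<Sum>e\<in>E. if e = {v, w} then s e * (\<Sum>u\<in>e. \<sigma> u) else 0)"
    by (intro sum.cong) (auto simp: vanish cross)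
  then have R: "2 * \<sigma> v = (if {v, w} \<in> E then s {v, w} * (\<sigma> v + \<sigma> w) else 0)"
    using L vw finite_E by (simp split: if_splits)
  show "{v, w} \<in> E"
    using R by (auto simp: \<sigma>_def split: if_splits)
  then show "\<not> crosses T {v, w}" "crosses S {v, w}"
    using R vw by (auto simp: crosses_pair \<sigma>_def s_def split: if_splits)
qed

theorem locally_optimal_half:
  assumes opt: "locally_optimal S"
  shows "ft_value T (V, E) \<le> 2 * ft_value S (V, E)"
proof (rule ccontr)
  assume "\<not> ?thesis"
  then have bad: "2 * int (ft_value S (V, E)) < int (ft_value T (V, E))"
    by simp
  define D where "D = max_cut_degree S"
  define X where "X = (\<Sum>u\<in>V. excess S u)"
  note nonneg = locally_optimal_excess[OF opt]
  have X4: "X = 4 * int (cut_size S (V, E)) - 2 * int (card E)"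
    by (simp add: X_def sum_excess)
  have ftS: "int (ft_value S (V, E)) = int (cut_size S (V, E)) - int D"
    using ft_value_eq[of S] by (simp add: D_def)
  have ft_bound: "int (ft_value T (V, E)) + int (vertex_degree u) \<le> int (card E)" if "u \<in> V" for u
    using ft_value_degree[OF that, of T] by linarith
  \<comment> \<open>From \<open>2 * (C - D) < card E - vertex_degree u\<close>, with
    \<open>C\<close> the size of the cut \<open>S\<close>, after doubling and subtracting
    \<open>2 * card E\<close>.\<close>
  have bound: "X < 2 * excess S u + 4 * (int D - int (cut_degree S u))" if "u \<in> V" for u
    using ft_bound[OF that] bad ftS X4 unfolding excess_def by presburger
  have X_sub: "sum (excess S) A \<le> X" if "A \<subseteq> V" for A
    unfolding X_def using that nonneg by (intro sum_mono2 finite_V) auto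
  obtain v where v: "v \<in> V" "cut_degree S v = D"
    unfolding D_def by (rule max_cut_degree_attained)
  have "even X"
    by (simp add: X4)
  then have Xv: "X \<le> 2 * excess S v - 2"
    using bound[OF v(1)] v(2) by presburger
  \<comment> \<open>A second vertex \<open>w\<close> of degree \<open>D\<close> would give
    \<open>X < 2 * excess S w\<close>; averaged with \<open>Xv\<close> this puts \<open>X\<close>
    below \<open>excess S v + excess S w\<close>, a partial sum of \<open>X\<close>.\<close>
  have uniq: "cut_degree S w < D" if "w \<in> V" "w \<noteq> v" for w
  proof (rule ccontr)
    assume "\<not> ?thesis"
    then have "cut_degree S w = D"
      using cut_degree_le_max[OF that(1), of S] by (simp add: D_def)
    then show False
      using bound[OF that(1)] Xv X_sub[of "{v, w}"] v that by simp
  qed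
  have swap: "\<exists>w\<in>V. w \<noteq> v \<and> w \<noteq> u \<and> {u, w} \<in> E \<and> \<not> crosses S {u, w} \<and> Suc (cut_degree S w) = D"
    if "{u, v} \<in> E" "crosses S {u, v}" "excess S u = 0" for u
    unfolding D_def
    by (rule locally_optimal_swap[OF opt v[unfolded D_def] _ that]) (use uniq in \<open>simp add: D_def\<close>)
  \<comment> \<open>The bounds \<open>2 * excess S v - 2\<close> and
    \<open>2 * excess S w + 2\<close> on \<open>X\<close> average to
    \<open>excess S v + excess S w\<close>, which is also a lower bound. So all of these are equal
    and no excess is left for other vertices.\<close>
  have near: "excess S w = excess S v - 2 \<and> X = excess S v + excess S w \<and>
      (\<forall>u\<in>V - {v, w}. excess S u = 0)"
    if "w \<in> V" "w \<noteq> v" "Suc (cut_degree S w) = D" for w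
  proof -
    have "X < 2 * excess S w + 4"
      using bound[OF that(1)] that(3) by auto
    then have X: "X \<le> 2 * excess S w + 2"
      using \<open>even X\<close> by presburger
    have *: "excess S v + excess S w \<le> X"
      using X_sub[of "{v, w}"] v that by simp
    have eq: "excess S w = excess S v - 2" "X = excess S v + excess S w"
      using X Xv * by linarith+
    have "excess S u = 0" if "u \<in> V - {v, w}" for u
      using X_sub[of "{u, v, w}"] v \<open>w \<in> V\<close> \<open>w \<noteq> v\<close> that nonneg[of u] eq by auto
    then show ?thesis
      using eq by auto
  qed
  define N where "N = {u \<in> V. {v, u} \<in> E \<and> (v \<in> S) \<noteq> (u \<in> S)}"
  have cardN: "card N = D" and finN: "finite N" and vN: "v \<notin> N" and NV: "N \<subseteq> V"
    using v(2) finite_V by (auto simp: N_def cut_degree_neighbors)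
  have N: "{u, v} \<in> E" "crosses S {u, v}" if "u \<in> N" for u
    using that edge_neq[of v u] by (auto simp: N_def insert_commute crosses_pair)
  \<comment> \<open>Otherwise the \<open>D\<close> vertices of \<open>N\<close> add at least
    \<open>D\<close> to \<open>X\<close>, so \<open>Xv\<close> forces
    \<open>D + 2 \<le> excess S v\<close>, although \<open>excess S v\<close> is at most
    \<open>D\<close>.\<close>
  have "\<exists>u\<in>N. excess S u = 0"
  proof (rule ccontr)
    assume "\<not> ?thesis"
    then have "excess S u \<ge> 1" if "u \<in> N" for u
      using nonneg[of u] NV that by force
    then have "int D \<le> sum (excess S) N"
      using sum_mono[of N "\<lambda>_. 1" "excess S"] cardN by simp
    then show False
      using X_sub[of "insert v N"] v NV vN finN Xv excess_le_cut_degree[of S v] by simp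
  qed
  then obtain u0 where "u0 \<in> N" "excess S u0 = 0"
    by auto
  then obtain w where w: "w \<in> V" "w \<noteq> v" "Suc (cut_degree S w) = D"
    using swap[of u0] N[of u0] by blast
  \<comment> \<open>If not, \<open>near\<close> makes \<open>w\<close> the only vertex that a swap
    can produce. Then all of \<open>N\<close> except possibly \<open>w\<close> itself are uncut
    neighbours of \<open>w\<close>, at least \<open>D - 1\<close> of them. As \<open>w\<close> has
    only \<open>D - 1\<close> cut edges, its excess is not positive.\<close>
  have w0: "excess S w = 0"
  proof (rule ccontr)
    assume nz: "excess S w \<noteq> 0"
    have "{u, w} \<in> E \<and> \<not> crosses S {u, w}" if u: "u \<in> N - {w}" for u
    proof -
      have "excess S u = 0"
        using near[OF w] u NV vN by auto
      then obtain w' where w': "w' \<in> V" "w' \<noteq> v" "{u, w'} \<in> E" "\<not> crosses S {u, w'}"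
          "Suc (cut_degree S w') = D"
        using swap[of u] N[of u] u by blast
      have "w' = w"
      proof (rule ccontr)
        assume "w' \<noteq> w"
        then have "excess S w' = 0"
          using near[OF w] w' by simp
        then show False
          using near[OF w] near[OF w'(1,2,5)] nz by linarith
      qed
      then show ?thesis
        using w' by simp
    qed
    then have "(\<lambda>u. {u, w}) ` (N - {w}) \<subseteq> {e \<in> E. w \<in> e \<and> \<not> crosses S e}"
      by auto
    then have "card ((\<lambda>u. {u, w}) ` (N - {w})) \<le> card {e \<in> E. w \<in> e \<and> \<not> crosses S e}"
      by (intro card_mono) (auto simp: finite_E)
    moreover have "inj_on (\<lambda>u. {u, w}) (N - {w})"
      by (auto simp: inj_on_def doubleton_eq_iff)
    ultimately have "card (N - {w}) \<le> card {e \<in> E. w \<in> e \<and> \<not> crosses S e}"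
      by (simp add: card_image)
    moreover have "D \<le> Suc (card (N - {w}))"
      using cardN finN by (cases "w \<in> N") auto
    ultimately show False
      using uncut_degree[of w S] w nz nonneg[OF w(1)] by (simp add: excess_def)
  qed
  then have v2: "excess S v = 2" and X2: "X = 2" and zero: "\<forall>u\<in>V - {v}. excess S u = 0"
    using near[OF w] by auto
  have deg: "vertex_degree w = vertex_degree v"
    using w0 v2 w(3) v(2) by (simp add: excess_def)
  \<comment> \<open>\<open>X = 2\<close> leaves no integer strictly between the lower bound
    \<open>bad\<close> and the upper bound \<open>ft_bound\<close>.\<close>
  have tight: "ft_value T (V, E) + vertex_degree v = card E"
    using ft_bound[OF v(1)] bad ftS X4 X2 v2 v(2) unfolding excess_def by presburger
  \<comment> \<open>By \<open>deg\<close> the bound is tight at \<open>w\<close> as well as at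
    \<open>v\<close>, and every edge other than \<open>{v, w}\<close> avoids one of the two.\<close>
  have "crosses T e" if e: "e \<in> E" "e \<noteq> {v, w}" for e
  proof (cases "v \<in> e")
    case True
    then have "w \<notin> e"
      using edge_eq[of e v w] e w(2) by auto
    then show ?thesis
      using all_cross_of_ft_value[OF w(1) _ e(1), of T] tight deg by simp
  qed (use all_cross_of_ft_value[OF v(1) tight e(1)] in simp)
  then have cross: "\<forall>e\<in>E - {{v, w}}. crosses T e"
    by simp
  note vw = excess_parity_contradiction[OF v(1) v2 w(1) zero cross w(2)[symmetric]]
  obtain w' where w': "w' \<in> V" "w' \<noteq> v" "w' \<noteq> w" "Suc (cut_degree S w') = D"
    using swap[of w] vw w0 by (auto simp: insert_commute[of w v])
  have "vertex_degree w' = vertex_degree v"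
    using zero w' v2 v(2) by (auto simp: excess_def)
  moreover have "cut_degree T w' = vertex_degree w'"
  proof -
    have "{e \<in> E. w' \<in> e \<and> crosses T e} = {e \<in> E. w' \<in> e}"
      using cross w' by auto
    then show ?thesis
      by (simp add: cut_degree_def vertex_degree_def)
  qed
  \<comment> \<open>\<open>T\<close> misses \<open>{v, w}\<close> but cuts every edge at
    \<open>w'\<close>. A fault at \<open>w'\<close> therefore leaves fewer than
    \<open>card E - vertex_degree v\<close> cut edges, against \<open>tight\<close>.\<close>
  moreover have "cut_size T (V, E) < card E"
    unfolding cut_size_crosses using vw by (intro psubset_card_mono finite_E) auto
  ultimately show False
    using ft_value_le[OF w'(1), of T] tight by simp
qed

end

section \<open>Reasoning about programs and their running time\<close>

text \<open>A total-correctness precondition with a clock: \<open>t\<close> is the time already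
  spent, and \<open>Q\<close> sees the accumulated time.\<close>

definition wp :: "com \<Rightarrow> (store \<Rightarrow> nat \<Rightarrow> bool) \<Rightarrow> store \<Rightarrow> nat \<Rightarrow> bool" where
  "wp c Q s t \<longleftrightarrow> (\<exists>t' s'. exec c s t' s' \<and> Q s' (t + t'))"

lemma wp_Skip: "Q s (t + 1) \<Longrightarrow> wp Skip Q s t"
  unfolding wp_def using exec.Skip by blast

lemma wp_Assign:
  "Q (s(x := (s x)(aval i s := aval a s))) (t + (1 + acost i + acost a)) \<Longrightarrow> wp (Assign x i a) Q s t"
  unfolding wp_def using exec.Assign by blast

lemma wp_Seq: "wp c1 (wp c2 Q) s t \<Longrightarrow> wp (Seq c1 c2) Q s t"
  unfolding wp_def using exec.Seq by (metis add.assoc)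

lemma wp_If:
  assumes "bval b s \<Longrightarrow> wp c1 Q s (t + (1 + bcost b))"
    and "\<not> bval b s \<Longrightarrow> wp c2 Q s (t + (1 + bcost b))"
  shows "wp (If b c1 c2) Q s t"
  using assms unfolding wp_def by (metis IfTrue IfFalse add.assoc)

text \<open>\<open>\<mu>\<close> bounds the number of remaining passes and \<open>B\<close> the cost
  of one. Each pass is specified from clock 0, so \<open>B\<close> does not depend on the time spent
  before.\<close>

lemma wp_While:
  fixes \<mu> :: "store \<Rightarrow> nat"
  assumes init: "I s"
    and step: "\<And>s. I s \<Longrightarrow> bval b s \<Longrightarrow> wp c (\<lambda>s' t'. I s' \<and> \<mu> s' < \<mu> s \<and> t' \<le> B) s 0"
    and post: "\<And>s' t'. I s' \<Longrightarrow> \<not> bval b s' \<Longrightarrow>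
      t' \<le> t + \<mu> s * (1 + bcost b + B) + (1 + bcost b) \<Longrightarrow> Q s' t'"
  shows "wp (While b c) Q s t"
proof -
  have "\<exists>t' s'. exec (While b c) s t' s' \<and> I s' \<and> \<not> bval b s' \<and>
      t' \<le> \<mu> s * (1 + bcost b + B) + (1 + bcost b)"
    using init
  proof (induction "\<mu> s" arbitrary: s rule: less_induct)
    case less
    show ?case
    proof (cases "bval b s")
      case True
      then obtain t1 s1 where 1: "exec c s t1 s1" "I s1" "\<mu> s1 < \<mu> s" "t1 \<le> B"
        using step[OF less.prems] by (auto simp: wp_def)
      obtain t2 s2 where 2: "exec (While b c) s1 t2 s2" "I s2" "\<not> bval b s2"
          "t2 \<le> \<mu> s1 * (1 + bcost b + B) + (1 + bcost b)"
        using less.hyps[OF 1(3,2)] by auto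
      have "Suc (\<mu> s1) * (1 + bcost b + B) \<le> \<mu> s * (1 + bcost b + B)"
        using 1(3) by (intro mult_le_mono1) simp
      then have "1 + bcost b + t1 + t2 \<le> \<mu> s * (1 + bcost b + B) + (1 + bcost b)"
        using 1(4) 2(4) by simp
      then show ?thesis
        using WhileTrue[OF True 1(1) 2(1)] 2(2,3) by blast
    next
      case False
      then show ?thesis
        using WhileFalse[OF False] less.prems by (intro exI[of _ "1 + bcost b"] exI[of _ s]) auto
    qed
  qed
  then show ?thesis
    unfolding wp_def using post by (metis add.assoc add_le_cancel_left)
qed

abbreviation Var :: "string \<Rightarrow> aexp" where
  "Var x \<equiv> Read x (Const 0)"

abbreviation Set_var :: "string \<Rightarrow> aexp \<Rightarrow> com" where
  "Set_var x \<equiv> Assign x (Const 0)"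

abbreviation Increment :: "string \<Rightarrow> com" where
  "Increment x \<equiv> Set_var x (Plus (Var x) (Const 1))"

section \<open>The local search program\<close>

text \<open>\<open>c\<close> and \<open>d\<close> hold the sum and the maximum of the cut degrees of the current cut, \<open>x\<close> and \<open>y\<close> those of
  the flipped cut. The matrix index \<open>k = i * n + j\<close> is carried along because the language has no
  multiplication. Every improvement restarts the scan at vertex \<open>u = 0\<close>, so that \<open>u = n\<close> certifies local
  optimality.\<close>

definition row_scan :: com where
  "row_scan =
    Seq (Set_var ''z'' (Const 0)) (Seq (Set_var ''j'' (Const 0))
      (While (Less (Var ''j'') (Var ''n''))
        (Seq (If (And (Equal (Read ''A'' (Var ''k'')) (Const 1))
                      (Not (Equal (Read ''S'' (Var ''i'')) (Read ''S'' (Var ''j'')))))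
                 (Increment ''z'') Skip)
        (Seq (Increment ''k'') (Increment ''j'')))))"

definition evaluate :: com where
  "evaluate =
    Seq (Set_var ''x'' (Const 0)) (Seq (Set_var ''y'' (Const 0))
      (Seq (Set_var ''k'' (Const 0)) (Seq (Set_var ''i'' (Const 0))
        (While (Less (Var ''i'') (Var ''n''))
          (Seq row_scan (Seq (Set_var ''x'' (Plus (Var ''x'') (Var ''z'')))
            (Seq (If (Less (Var ''y'') (Var ''z'')) (Set_var ''y'' (Var ''z'')) Skip)
              (Increment ''i''))))))))"

definition flip_cell :: com where
  "flip_cell = Assign ''S'' (Var ''u'') (Minus (Const 1) (Read ''S'' (Var ''u'')))"

definition local_search :: com where
  "local_search =
    While (Less (Var ''u'') (Var ''n''))
      (Seq flip_cell (Seq evaluate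
        (If (And (Not (Less (Var ''c'') (Var ''x'')))
                 (Not (And (Equal (Var ''c'') (Var ''x'')) (Less (Var ''y'') (Var ''d'')))))
            (Seq flip_cell (Increment ''u''))
            (Seq (Set_var ''c'' (Var ''x'')) (Seq (Set_var ''d'' (Var ''y''))
              (Set_var ''u'' (Const 0)))))))"

section \<open>Cut statistics of plain arrays, by prefixes as the loops build them\<close>

definition row_cut :: "(nat \<Rightarrow> nat) \<Rightarrow> nat \<Rightarrow> (nat \<Rightarrow> nat) \<Rightarrow> nat \<Rightarrow> nat \<Rightarrow> nat" where
  "row_cut a n f i m = card {j. j < m \<and> a (i * n + j) = 1 \<and> f i \<noteq> f j}"

text \<open>For the adjacency matrix of a graph and \<open>m = n\<close> this is twice the cut size,
  each cut edge being seen from both ends.\<close>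

definition total_cut :: "(nat \<Rightarrow> nat) \<Rightarrow> nat \<Rightarrow> (nat \<Rightarrow> nat) \<Rightarrow> nat \<Rightarrow> nat" where
  "total_cut a n f m = (\<Sum>i<m. row_cut a n f i n)"

text \<open>The inserted 0 gives the empty prefix the value with which \<open>y\<close>
  starts.\<close>

definition max_cut :: "(nat \<Rightarrow> nat) \<Rightarrow> nat \<Rightarrow> (nat \<Rightarrow> nat) \<Rightarrow> nat \<Rightarrow> nat" where
  "max_cut a n f m = Max (insert 0 ((\<lambda>i. row_cut a n f i n) ` {..<m}))"

lemma row_cut_0: "row_cut a n f i 0 = 0"
  by (simp add: row_cut_def)

lemma row_cut_Suc:
  "row_cut a n f i (Suc m) = (if a (i * n + m) = 1 \<and> f i \<noteq> f m then Suc (row_cut a n f i m) else row_cut a n f i m)"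
proof -
  have "{j. j < Suc m \<and> a (i * n + j) = 1 \<and> f i \<noteq> f j} =
    (if a (i * n + m) = 1 \<and> f i \<noteq> f m then insert m {j. j < m \<and> a (i * n + j) = 1 \<and> f i \<noteq> f j}
     else {j. j < m \<and> a (i * n + j) = 1 \<and> f i \<noteq> f j})"
    by (auto simp: less_Suc_eq)
  then show ?thesis
    by (simp add: row_cut_def)
qed

lemma row_cut_le: "row_cut a n f i m \<le> m"
  unfolding row_cut_def by (rule order.trans[OF card_mono[of "{..<m}"]]) auto

lemma total_cut_0: "total_cut a n f 0 = 0"
  and total_cut_Suc: "total_cut a n f (Suc m) = total_cut a n f m + row_cut a n f m n"
  by (simp_all add: total_cut_def)

lemma total_cut_le: "total_cut a n f m \<le> m * n"
  unfolding total_cut_def using sum_bounded_above[of "{..<m}" "\<lambda>i. row_cut a n f i n" n]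
  by (simp add: row_cut_le)

lemma max_cut_0: "max_cut a n f 0 = 0"
  by (simp add: max_cut_def)

lemma max_cut_Suc: "max_cut a n f (Suc m) = max (max_cut a n f m) (row_cut a n f m n)"
proof -
  have "insert 0 ((\<lambda>i. row_cut a n f i n) ` {..<Suc m}) =
      insert (row_cut a n f m n) (insert 0 ((\<lambda>i. row_cut a n f i n) ` {..<m}))"
    by (auto simp: lessThan_Suc)
  then show ?thesis
    unfolding max_cut_def by (simp only:) (subst Max_insert, auto simp: max.commute)
qed

lemma max_cut_le: "max_cut a n f m \<le> n"
  by (simp add: max_cut_def row_cut_le)

section \<open>Frame conditions and loop specifications\<close>

definition same_except :: "string set \<Rightarrow> store \<Rightarrow> store \<Rightarrow> bool" where
  "same_except W s s' \<longleftrightarrow> (\<forall>x. x \<notin> W \<longrightarrow> s' x = s x)"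

lemma same_except_refl: "same_except W s s"
  and same_except_upd: "same_except W s s' \<Longrightarrow> x \<in> W \<Longrightarrow> same_except W s (s'(x := g))"
  and same_exceptD: "same_except W s s' \<Longrightarrow> x \<notin> W \<Longrightarrow> s' x = s x"
  by (auto simp: same_except_def)

lemma same_except_trans: "same_except W s s' \<Longrightarrow> same_except W' s' s'' \<Longrightarrow> W' \<subseteq> W \<Longrightarrow> same_except W s s''"
  unfolding same_except_def by (metis subsetD)

lemma wp_row_scan:
  assumes n: "s ''n'' 0 = n" and k: "s ''k'' 0 = s ''i'' 0 * n"
    and Q: "\<And>s' t'. same_except {''z'', ''j'', ''k''} s s' \<Longrightarrow>
      s' ''z'' 0 = row_cut (s ''A'') n (s ''S'') (s ''i'' 0) n \<Longrightarrow>
      s' ''k'' 0 = Suc (s ''i'' 0) * n \<Longrightarrow> t' \<le> t + (46 * n + 20) \<Longrightarrow> Q s' t'"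
  shows "wp row_scan Q s t"
  unfolding row_scan_def
\<comment> \<open>At most 40 for a pass plus 6 for the guard gives the slope 46; these constants
  leave slack.\<close>
proof (intro wp_Seq wp_Assign, rule wp_While[where B = 40 and \<mu> = "\<lambda>s'. n - s' ''j'' 0" and
    I = "\<lambda>s'. same_except {''z'', ''j'', ''k''} s s' \<and> s' ''j'' 0 \<le> n \<and>
      s' ''k'' 0 = s ''i'' 0 * n + s' ''j'' 0 \<and>
      s' ''z'' 0 = row_cut (s ''A'') n (s ''S'') (s ''i'' 0) (s' ''j'' 0)"], goal_cases init step post)
  case init
  show ?case
    using n k by (auto simp: same_except_refl same_except_upd row_cut_0)
next
  case (step s')
  then have same: "same_except {''z'', ''j'', ''k''} s s'" by simp
  have eqs: "s' ''n'' = s ''n''" "s' ''A'' = s ''A''" "s' ''S'' = s ''S''" "s' ''i'' = s ''i''"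
    by (rule same_exceptD[OF same]; simp)+
  show ?case
    by (intro wp_Seq wp_If wp_Assign wp_Skip)
      (use step n in \<open>auto simp: same_except_upd eqs row_cut_Suc\<close>)
next
  case (post s' t')
  then show ?case
    using n by (intro Q) (auto simp: same_exceptD algebra_simps)
qed

lemma wp_evaluate:
  assumes n: "s ''n'' 0 = n"
    and Q: "\<And>s' t'. same_except {''x'', ''y'', ''z'', ''i'', ''j'', ''k''} s s' \<Longrightarrow>
      s' ''x'' 0 = total_cut (s ''A'') n (s ''S'') n \<Longrightarrow>
      s' ''y'' 0 = max_cut (s ''A'') n (s ''S'') n \<Longrightarrow> t' \<le> t + (n * (46 * n + 60) + 20) \<Longrightarrow> Q s' t'"
  shows "wp evaluate Q s t"
  unfolding evaluate_def
proof (intro wp_Seq wp_Assign, rule wp_While[where B = "46 * n + 50" and \<mu> = "\<lambda>s'. n - s' ''i'' 0" and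
    I = "\<lambda>s'. same_except {''x'', ''y'', ''z'', ''i'', ''j'', ''k''} s s' \<and> s' ''i'' 0 \<le> n \<and>
      s' ''k'' 0 = s' ''i'' 0 * n \<and>
      s' ''x'' 0 = total_cut (s ''A'') n (s ''S'') (s' ''i'' 0) \<and>
      s' ''y'' 0 = max_cut (s ''A'') n (s ''S'') (s' ''i'' 0)"], goal_cases init step post)
  case init
  show ?case
    by (auto simp: same_except_refl same_except_upd total_cut_0 max_cut_0)
next
  case (step s')
  then have same: "same_except {''x'', ''y'', ''z'', ''i'', ''j'', ''k''} s s'" by simp
  have eqs: "s' ''n'' = s ''n''" "s' ''A'' = s ''A''" "s' ''S'' = s ''S''"
    by (rule same_exceptD[OF same]; simp)+
  show ?case
  proof (intro wp_Seq, rule wp_row_scan[where n = n], goal_cases n k row)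
    case (row s1 t1)
    then have same1: "same_except {''x'', ''y'', ''z'', ''i'', ''j'', ''k''} s s1"
      by (auto intro: same_except_trans[OF same])
    have eqs1: "s1 ''n'' = s' ''n''" "s1 ''i'' = s' ''i''" "s1 ''x'' = s' ''x''" "s1 ''y'' = s' ''y''"
      by (rule same_exceptD[OF row(1)]; simp)+
    show ?case
      by (intro wp_Seq wp_If wp_Assign wp_Skip)
        (use step n row same1 in \<open>auto simp: same_except_upd eqs eqs1 total_cut_Suc max_cut_Suc\<close>)
  qed (use step n eqs in auto)
next
  case (post s' t')
  then show ?case
    using n by (intro Q) (auto simp: same_exceptD algebra_simps)
qed

section \<open>Progress of the local search\<close>

definition better :: "(nat \<Rightarrow> nat) \<Rightarrow> nat \<Rightarrow> (nat \<Rightarrow> nat) \<Rightarrow> (nat \<Rightarrow> nat) \<Rightarrow> bool" where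
  "better a n f' f \<longleftrightarrow> total_cut a n f n < total_cut a n f' n \<or>
     total_cut a n f n = total_cut a n f' n \<and> max_cut a n f' n < max_cut a n f n"

text \<open>The lexicographic order of \<open>better\<close> packed into one number: the second
  summand is at most \<open>n\<close>, so a step of the first outweighs it.\<close>

definition potential :: "(nat \<Rightarrow> nat) \<Rightarrow> nat \<Rightarrow> (nat \<Rightarrow> nat) \<Rightarrow> nat" where
  "potential a n f = total_cut a n f n * (n + 1) + (n - max_cut a n f n)"

lemma potential_le: "potential a n f \<le> n * n * (n + 1) + n"
  unfolding potential_def by (intro add_mono mult_le_mono total_cut_le) auto

lemma better_potential:
  assumes "better a n f' f"
  shows "potential a n f < potential a n f'"
proof (cases "total_cut a n f n < total_cut a n f' n")
  case True
  then have "Suc (total_cut a n f n) * (n + 1) \<le> total_cut a n f' n * (n + 1)"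
    by (intro mult_le_mono1) simp
  then show ?thesis
    unfolding potential_def by simp
next
  case False
  then show ?thesis
    using assms max_cut_le[of a n f n] by (auto simp: better_def potential_def)
qed

lemma wp_local_search:
  assumes n: "s ''n'' 0 = n" and zero: "s ''S'' = (\<lambda>_. 0)" "s ''c'' 0 = 0" "s ''d'' 0 = 0" "s ''u'' 0 = 0"
    and Q: "\<And>s' t'. \<forall>v. s' ''S'' v \<le> 1 \<Longrightarrow>
      \<forall>w<n. \<not> better (s ''A'') n ((s' ''S'')(w := 1 - s' ''S'' w)) (s' ''S'') \<Longrightarrow>
      t' \<le> t + ((n * n * (n + 1) + n) * (n + 1) + n) * (6 + (n * (46 * n + 60) + 94)) + 6 \<Longrightarrow> Q s' t'"
  shows "wp local_search Q s t"
  unfolding local_search_def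
\<comment> \<open>The measure is lexicographic too: first the potential still to be gained, then the
  rest of the scan. The factor \<open>n + 1\<close> pays for resetting \<open>u\<close> to 0 after
  an improvement.\<close>
proof (rule wp_While[where B = "n * (46 * n + 60) + 94" and
    \<mu> = "\<lambda>s'. (n * n * (n + 1) + n - potential (s ''A'') n (s' ''S'')) * (n + 1) + (n - s' ''u'' 0)" and
    I = "\<lambda>s'. s' ''n'' 0 = n \<and> s' ''A'' = s ''A'' \<and> (\<forall>v. s' ''S'' v \<le> 1) \<and>
      s' ''c'' 0 = total_cut (s ''A'') n (s' ''S'') n \<and> s' ''d'' 0 = max_cut (s ''A'') n (s' ''S'') n \<and>
      s' ''u'' 0 \<le> n \<and>
      (\<forall>w<s' ''u'' 0. \<not> better (s ''A'') n ((s' ''S'')(w := 1 - s' ''S'' w)) (s' ''S''))"],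
    goal_cases init step post)
  case init
  \<comment> \<open>The search starts from the empty cut, for which the initial zeros in
    \<open>c\<close> and \<open>d\<close> are already correct.\<close>
  have "row_cut (s ''A'') n (\<lambda>_. 0) i n = 0" for i
    by (simp add: row_cut_def)
  then have "total_cut (s ''A'') n (\<lambda>_. 0) n = 0" "max_cut (s ''A'') n (\<lambda>_. 0) n = 0"
    by (simp_all add: total_cut_def max_cut_def image_constant_conv)
  then show ?case
    using n zero by simp
next
  case (step s')
  define u where "u = s' ''u'' 0"
  define f where "f = s' ''S''"
  define f' where "f' = f(u := 1 - f u)"
  have u: "u < n"
    using step by (simp add: u_def)
  \<comment> \<open>A second flip restores the cell only because its value is at most 1; subtraction
    is truncated.\<close>
  have undo: "f'(u := 1 - f' u) = f"
    using step by (auto simp: f'_def f_def fun_eq_iff)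
  have range: "f' v \<le> 1" for v
    using step by (auto simp: f'_def f_def)
  show ?case
    unfolding flip_cell_def
  proof (intro wp_Seq wp_Assign, rule wp_evaluate[where n = n], goal_cases n eval)
    case n
    then show ?case
      using step by simp
  next
    case (eval s1 t1)
    have eqs: "s1 ''S'' = f'" "s1 ''n'' = s' ''n''" "s1 ''A'' = s ''A''" "s1 ''c'' = s' ''c''"
        "s1 ''d'' = s' ''d''" "s1 ''u'' = s' ''u''"
      using step same_exceptD[OF eval(1)] by (simp_all add: f'_def f_def u_def)
    have xy: "s1 ''x'' 0 = total_cut (s ''A'') n f' n" "s1 ''y'' 0 = max_cut (s ''A'') n f' n"
      using step eval(2,3) by (simp_all add: f'_def f_def u_def)
    have cd: "s1 ''c'' 0 = total_cut (s ''A'') n f n" "s1 ''d'' 0 = max_cut (s ''A'') n f n"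
      using step eqs by (simp_all add: f_def)
    have t1: "t1 \<le> n * (46 * n + 60) + 28"
      using eval(4) by simp
    show ?case
    proof (rule wp_If, goal_cases worse better)
      case worse
      then have nb: "\<not> better (s ''A'') n f' f"
        by (simp add: better_def xy cd)
      have "\<not> better (s ''A'') n (f(w := 1 - f w)) f" if "w < Suc u" for w
        using that nb step by (cases "w = u") (auto simp: f'_def u_def f_def)
      then show ?case
        by (intro wp_Seq wp_Assign)
          (use step t1 u undo in \<open>simp add: eqs cd u_def[symmetric] f_def[symmetric]\<close>)
    next
      case better
      then have "better (s ''A'') n f' f"
        by (auto simp: better_def xy cd)
      then have pot: "potential (s ''A'') n f < potential (s ''A'') n f'"
        by (rule better_potential)
      have "Suc (n * n * (n + 1) + n - potential (s ''A'') n f') \<le>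
          n * n * (n + 1) + n - potential (s ''A'') n f"
        by (rule Suc_leI[OF diff_less_mono2[OF pot order.strict_trans2[OF pot potential_le]]])
      then have "Suc (n * n * (n + 1) + n - potential (s ''A'') n f') * (n + 1) \<le>
          (n * n * (n + 1) + n - potential (s ''A'') n f) * (n + 1)"
        by (rule mult_le_mono1)
      then have "(n * n * (n + 1) + n - potential (s ''A'') n f') * (n + 1) + n <
          (n * n * (n + 1) + n - potential (s ''A'') n f) * (n + 1) + (n - u)"
        by simp
      then show ?case
        by (intro wp_Seq wp_Assign)
          (use step t1 range in \<open>simp add: eqs cd xy u_def[symmetric] f_def[symmetric] del: mult_Suc_right add_Suc_right\<close>)
    qed
  qed
next
  case (post s' t')
  have "(n * n * (n + 1) + n - potential (s ''A'') n (s ''S'')) * (n + 1) + (n - s ''u'' 0) \<le>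
      (n * n * (n + 1) + n) * (n + 1) + n"
    by (intro add_mono mult_le_mono1) auto
  then have "((n * n * (n + 1) + n - potential (s ''A'') n (s ''S'')) * (n + 1) + (n - s ''u'' 0)) *
        (6 + (n * (46 * n + 60) + 94)) \<le>
      ((n * n * (n + 1) + n) * (n + 1) + n) * (6 + (n * (46 * n + 60) + 94))"
    by (rule mult_le_mono1)
  moreover have "1 + bcost (Less (Var ''u'') (Var ''n'')) = 6"
    by simp
  ultimately have "t' \<le> t + ((n * n * (n + 1) + n) * (n + 1) + n) * (6 + (n * (46 * n + 60) + 94)) + 6"
    using post(3) by (simp only:)
  moreover have "s' ''u'' 0 = n"
    using post(1,2) by auto
  ultimately show ?case
    using post(1) by (intro Q) simp_all
qed

section \<open>From arrays back to graphs\<close>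

locale matrix_graph = finite_simple_graph "{..<n}" E
  for n :: nat and E :: "nat set set" +
  fixes a :: "nat \<Rightarrow> nat"
  assumes adjacency: "i < n \<Longrightarrow> j < n \<Longrightarrow> a (i * n + j) = 1 \<longleftrightarrow> {i, j} \<in> E"
begin

lemma array_cut:
  assumes f: "\<forall>v. f v \<le> 1"
  shows "total_cut a n f n = 2 * cut_size {v. v < n \<and> f v \<noteq> 0} ({..<n}, E)"
    and "max_cut a n f n = max_cut_degree {v. v < n \<and> f v \<noteq> 0}"
proof -
  \<comment> \<open>The program compares cells for equality; for 0/1 cells this means lying on the
    same side.\<close>
  have eq: "f i = f j \<longleftrightarrow> (f i = 0 \<longleftrightarrow> f j = 0)" for i j
    using f[rule_format, of i] f[rule_format, of j] by linarith
  have row: "row_cut a n f i n = cut_degree {v. v < n \<and> f v \<noteq> 0} i" if "i < n" for i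
    unfolding row_cut_def cut_degree_neighbors
    by (rule arg_cong[where f = card], rule Collect_cong) (use that adjacency[of i] eq[of i] in auto)
  show "total_cut a n f n = 2 * cut_size {v. v < n \<and> f v \<noteq> 0} ({..<n}, E)"
    unfolding total_cut_def sum_cut_degree[symmetric] by (intro sum.cong) (simp_all add: row)
  have "(\<lambda>i. row_cut a n f i n) ` {..<n} = cut_degree {v. v < n \<and> f v \<noteq> 0} ` {..<n}"
    by (intro image_cong) (simp_all add: row)
  then show "max_cut a n f n = max_cut_degree {v. v < n \<and> f v \<noteq> 0}"
    using finite_V nonempty by (simp add: max_cut_def max_cut_degree_def)
qed

text \<open>Doubling the cut size does not affect comparisons, so \<open>better\<close> on arrays
  and \<open>improves\<close> on cuts agree.\<close>

lemma array_locally_optimal: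
  assumes f: "\<forall>v. f v \<le> 1" and opt: "\<And>w. w < n \<Longrightarrow> \<not> better a n (f(w := 1 - f w)) f"
  shows "locally_optimal {v. v < n \<and> f v \<noteq> 0}"
  unfolding locally_optimal_def
proof
  fix w assume "w \<in> {..<n}"
  then have w: "w < n"
    by simp
  have f': "\<forall>v. (f(w := 1 - f w)) v \<le> 1"
    using f by simp
  have flip: "{v. v < n \<and> (f(w := 1 - f w)) v \<noteq> 0} = flip w {v. v < n \<and> f v \<noteq> 0}"
    using w f[rule_format, of w] by (auto simp: mem_flip)
  show "\<not> improves (flip w {v. v < n \<and> f v \<noteq> 0}) {v. v < n \<and> f v \<noteq> 0}"
    using opt[OF w] unfolding better_def improves_def array_cut[OF f] array_cut[OF f'] flip
    by simp
qed

end

theorem theorem4: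
  "\<exists>(P :: com) (p :: nat poly). \<forall>(n :: nat) (E :: nat set set).
     n \<ge> 1 \<longrightarrow> simple_graph ({..<n}, E) \<longrightarrow>
     (\<exists>t s. exec P (graph_input n E) t s \<and> t \<le> poly p n \<and>
        cut_output n s \<subseteq> {..<n} \<and>
        real (ft_value (cut_output n s) ({..<n}, E))
          \<ge> 1 / 2 * real (Max ((\<lambda>S'. ft_value S' ({..<n}, E)) ` Pow {..<n})))"
proof -
  let ?X = "[:0, 1:] :: nat poly"
  \<comment> \<open>The time bound of \<open>wp_local_search\<close> from clock 0, with the
    indeterminate in place of \<open>n\<close>.\<close>
  let ?p = "((?X * ?X * (?X + 1) + ?X) * (?X + 1) + ?X) * ([:6:] + (?X * ([:46:] * ?X + [:60:]) + [:94:])) + [:6:]"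
  show ?thesis
  proof (intro exI[of _ local_search] exI[of _ ?p] allI impI)
    fix n :: nat and E :: "nat set set"
    assume n: "n \<ge> 1" and E: "simple_graph ({..<n}, E)"
    let ?s = "graph_input n E"
    have a: "?s ''A'' (i * n + j) = 1 \<longleftrightarrow> {i, j} \<in> E" if "i < n" "j < n" for i j
    proof -
      have "i * n + j < n * n"
        using that mult_le_mono1[of "Suc i" n n] by simp
      then show ?thesis
        using that by (simp add: graph_input_def)
    qed
    interpret matrix_graph n E "?s ''A''"
      using n E a by unfold_locales (auto simp: lessThan_empty_iff)
    have "wp local_search (\<lambda>s t. (\<forall>v. s ''S'' v \<le> 1) \<and>
        (\<forall>w<n. \<not> better (?s ''A'') n ((s ''S'')(w := 1 - s ''S'' w)) (s ''S'')) \<and>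
        t \<le> poly ?p n) ?s 0"
      by (rule wp_local_search[where n = n]) (auto simp: graph_input_def algebra_simps)
    then obtain t s where s: "exec local_search ?s t s" "t \<le> poly ?p n" "\<forall>v. s ''S'' v \<le> 1"
        "\<And>w. w < n \<Longrightarrow> \<not> better (?s ''A'') n ((s ''S'')(w := 1 - s ''S'' w)) (s ''S'')"
      by (auto simp: wp_def)
    have "locally_optimal (cut_output n s)"
      unfolding cut_output_def by (rule array_locally_optimal[OF s(3,4)])
    then have "ft_value T ({..<n}, E) \<le> 2 * ft_value (cut_output n s) ({..<n}, E)" for T
      by (rule locally_optimal_half)
    then have "Max ((\<lambda>S'. ft_value S' ({..<n}, E)) ` Pow {..<n}) \<le> 2 * ft_value (cut_output n s) ({..<n}, E)"
      by (intro Max.boundedI) auto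
    then have "1 / 2 * real (Max ((\<lambda>S'. ft_value S' ({..<n}, E)) ` Pow {..<n}))
        \<le> real (ft_value (cut_output n s) ({..<n}, E))"
      by linarith
    moreover have "cut_output n s \<subseteq> {..<n}"
      by (auto simp: cut_output_def)
    ultimately show "\<exists>t s. exec local_search ?s t s \<and> t \<le> poly ?p n \<and>
        cut_output n s \<subseteq> {..<n} \<and>
        real (ft_value (cut_output n s) ({..<n}, E))
          \<ge> 1 / 2 * real (Max ((\<lambda>S'. ft_value S' ({..<n}, E)) ` Pow {..<n}))"
      using s(1,2) by blast
  qed
qed

end
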